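(* For every integer $n\geq1$, $$[x]\,U_{2n-2}\!\left(\frac1x\right)\arcsin x=\frac{(-1)^{n-1}}{2n-1}.$$
   Context: $U_m$ is the Chebyshev polynomial of the second kind, normalized by $U_m(\cos\theta)=\frac{\sin((m+1)\theta)}{\sin\theta}$. For a Laurent series $F$, $[x]F(x)$ denotes the coefficient of $x^1$ in the Laurent expansion of $F$ at $x=0$; $\arcsin$ is the principal branch. *)

theory Defs
  imports "HOL-Complex_Analysis.Complex_Analysis"
begin

definition chebyshev_U :: "nat \<Rightarrow> complex poly" where
  "chebyshev_U m = (THE p. \<forall>\<theta>. sin \<theta> \<noteq> 0 \<longrightarrow>
     poly p (cos \<theta>) = sin (of_nat (m + 1) * \<theta>) / sin \<theta>)"

lemma chebyshev_U_exists:
  "\<exists>p :: complex poly. \<forall>\<theta>. sin \<theta> \<noteq> 0 \<longrightarrow>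
     poly p (cos \<theta>) = sin (of_nat (m + 1) * \<theta>) / sin \<theta>"
proof (induction m rule: induct_nat_012)
  case 0
  show ?case by (intro exI[of _ 1]) auto
next
  case 1
  show ?case by (intro exI[of _ "[:0, 2:]"]) (auto simp: sin_double)
next
  case (ge2 n)
  obtain p where p: "\<And>\<theta>. sin \<theta> \<noteq> 0 \<Longrightarrow>
      poly p (cos \<theta>) = sin (of_nat (n + 1) * \<theta>) / sin (\<theta>::complex)"
    using ge2(1) by blast
  obtain q where q: "\<And>\<theta>. sin \<theta> \<noteq> 0 \<Longrightarrow>
      poly q (cos \<theta>) = sin (of_nat (Suc n + 1) * \<theta>) / sin (\<theta>::complex)"
    using ge2(2) by blast
  have "poly ([:0, 2:] * q - p) (cos \<theta>) = sin (of_nat (Suc (Suc n) + 1) * \<theta>) / sin \<theta>"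
    if \<theta>: "sin \<theta> \<noteq> 0" for \<theta> :: complex
  proof -
    have 1: "of_nat (n + 1) * \<theta> = of_nat (Suc n + 1) * \<theta> - \<theta>"
      and 2: "of_nat (Suc (Suc n) + 1) * \<theta> = of_nat (Suc n + 1) * \<theta> + \<theta>"
      by (simp_all add: algebra_simps)
    have "sin (of_nat (Suc (Suc n) + 1) * \<theta>) =
            2 * cos \<theta> * sin (of_nat (Suc n + 1) * \<theta>) - sin (of_nat (n + 1) * \<theta>)"
      unfolding 1 2 sin_add sin_diff by (simp add: algebra_simps)
    thus ?thesis
      using p[OF \<theta>] q[OF \<theta>] by (simp add: diff_divide_distrib)
  qed
  thus ?case by blast
qed

lemma chebyshev_U_unique:
  fixes p q :: "complex poly"
  assumes "\<And>\<theta>. sin \<theta> \<noteq> 0 \<Longrightarrow> poly p (cos \<theta>) = poly q (cos \<theta>)"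
  shows "p = q"
proof -
  have "z \<in> {z. poly (p - q) z = 0} \<union> {1, -1}" for z
  proof (cases "sin (Arccos z) = 0")
    case True
    hence "z\<^sup>2 = 1"
      using sin_cos_squared_add[of "Arccos z"] by simp
    thus ?thesis by (auto simp: power2_eq_1_iff)
  next
    case False
    thus ?thesis using assms[of "Arccos z"] by simp
  qed
  hence "UNIV = {z. poly (p - q) z = 0} \<union> {1, -1}" by blast
  moreover have "infinite (UNIV :: complex set)" by (rule infinite_UNIV_char_0)
  ultimately have "infinite {z. poly (p - q) z = 0}"
    by (metis finite.emptyI finite_UnI finite_insert)
  thus ?thesis using poly_roots_finite[of "p - q"] by auto
qed

lemma chebyshev_U_cos:
  assumes "sin \<theta> \<noteq> 0"
  shows "poly (chebyshev_U m) (cos \<theta>) = sin (of_nat (m + 1) * \<theta>) / sin \<theta>"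
proof -
  have "\<exists>!p :: complex poly. \<forall>\<theta>. sin \<theta> \<noteq> 0 \<longrightarrow>
          poly p (cos \<theta>) = sin (of_nat (m + 1) * \<theta>) / sin \<theta>"
    by (rule ex_ex1I[OF chebyshev_U_exists]) (rule chebyshev_U_unique, simp)
  from theI'[OF this] show ?thesis
    unfolding chebyshev_U_def using assms by blast
qed

lemma chebyshev_U_0: "chebyshev_U 0 = 1"
  by (rule chebyshev_U_unique) (simp add: chebyshev_U_cos)

lemma chebyshev_U_1: "chebyshev_U 1 = [:0, 2:]"
  by (rule chebyshev_U_unique) (simp add: chebyshev_U_cos sin_double del: One_nat_def)

lemma chebyshev_U_Suc_Suc:
  "chebyshev_U (Suc (Suc n)) = [:0, 2:] * chebyshev_U (Suc n) - chebyshev_U n"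
proof (rule chebyshev_U_unique)
  fix \<theta> :: complex assume \<theta>: "sin \<theta> \<noteq> 0"
  have 1: "of_nat (n + 1) * \<theta> = of_nat (Suc n + 1) * \<theta> - \<theta>"
    and 2: "of_nat (Suc (Suc n) + 1) * \<theta> = of_nat (Suc n + 1) * \<theta> + \<theta>"
    by (simp_all add: algebra_simps)
  have "sin (of_nat (Suc (Suc n) + 1) * \<theta>) =
          2 * cos \<theta> * sin (of_nat (Suc n + 1) * \<theta>) - sin (of_nat (n + 1) * \<theta>)"
    unfolding 1 2 sin_add sin_diff by (simp add: algebra_simps)
  thus "poly (chebyshev_U (Suc (Suc n))) (cos \<theta>) =
          poly ([:0, 2:] * chebyshev_U (Suc n) - chebyshev_U n) (cos \<theta>)"
    using chebyshev_U_cos[OF \<theta>, of n] chebyshev_U_cos[OF \<theta>, of "Suc n"]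
      chebyshev_U_cos[OF \<theta>, of "Suc (Suc n)"]
    by (simp add: diff_divide_distrib)
qed

(* The library function laurent_expansion is total; here it is the actual Laurent expansion. *)
lemma has_laurent_expansion_U_arcsin:
  defines "f \<equiv> (\<lambda>m x. poly (chebyshev_U m) (1 / x) * Arcsin x)"
  shows "f m has_laurent_expansion laurent_expansion (f m) 0"
proof -
  have "Arcsin holomorphic_on ball 0 1"
  proof (rule holomorphic_on_Arcsin)
    fix z :: complex assume "z \<in> ball 0 1"
    thus "\<bar>Re z\<bar> < 1" using abs_Re_le_cmod[of z] by simp
  qed
  hence "Arcsin analytic_on {0}"
    by (auto simp: analytic_at intro!: exI[of _ "ball 0 1"])
  hence A: "Arcsin has_laurent_expansion fps_to_fls (fps_expansion Arcsin 0)"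
    by (intro has_laurent_expansion_fps analytic_at_imp_has_fps_expansion_0)
  have P: "\<exists>F. (\<lambda>x. poly p (1 / x)) has_laurent_expansion F" for p :: "complex poly"
  proof (induction p)
    case 0
    show ?case by auto
  next
    case (pCons a p)
    then obtain F where "(\<lambda>x. poly p (1 / x)) has_laurent_expansion F" by blast
    hence "(\<lambda>x. a + 1 / x * poly p (1 / x)) has_laurent_expansion
             (fls_const a + 1 / fls_X * F)"
      by (intro laurent_expansion_intros)
    thus ?case by auto
  qed
  obtain F where "(\<lambda>x. poly (chebyshev_U m) (1 / x)) has_laurent_expansion F"
    using P by blast
  from has_laurent_expansion_mult[OF this A] have "\<exists>G. f m has_laurent_expansion G"
    unfolding f_def by blast
  then obtain G where G: "f m has_laurent_expansion G" by blast
  with laurent_expansion_0_eqI[OF G] show ?thesis by simp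
qed

end

theory Submission
  imports Defs
begin

text \<open>
  Put $y = 1/x$, $m = 2n-1$ and let $T_m$ be the Chebyshev polynomial of the first kind, so that
  $T_m' = m U_{m-1}$. Then $[x]\,U_{m-1}(y)\arcsin x$ is the residue of
  $x^{-2} U_{m-1}(y) \arcsin x = -\frac1m \frac{d}{dx}(T_m(y)) \arcsin x$, and since residues of
  derivatives vanish, it equals $\frac1m$ times the residue of $T_m(y) / \sqrt{1-x^2}$.
  Now $T_m(y) = \sqrt{y^2-1}\, U_{m-1}(y) + (y - \sqrt{y^2-1})^m$ and
  $\sqrt{y^2-1} = y \sqrt{1-x^2}$. As $y - \sqrt{y^2-1} = (1-\sqrt{1-x^2})/x$ is a power series
  in $x$, only $y\, U_{m-1}(y)$ contributes to the residue, namely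
  $U_{2n-2}(0) = (-1)^{n-1}$.
\<close>

text \<open>\<open>cheb_V y m\<close> is $U_{m-1}(y)$, with $U_{-1} = 0$.\<close>

fun cheb_T :: "'a::comm_ring_1 \<Rightarrow> nat \<Rightarrow> 'a" and cheb_V :: "'a \<Rightarrow> nat \<Rightarrow> 'a" where
  "cheb_T y 0 = 1"
| "cheb_V y 0 = 0"
| "cheb_T y (Suc m) = y * cheb_T y m + (y\<^sup>2 - 1) * cheb_V y m"
| "cheb_V y (Suc m) = y * cheb_V y m + cheb_T y m"

lemma poly_chebyshev_U: "poly (chebyshev_U m) z = cheb_V z (Suc m)"
proof (induction m rule: induct_nat_012)
  case 0
  show ?case by (simp add: chebyshev_U_0)
next
  case 1
  show ?case using chebyshev_U_1 by simp
next
  case (ge2 m)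
  have "poly (chebyshev_U (Suc (Suc m))) z = 2 * z * cheb_V z (Suc (Suc m)) - cheb_V z (Suc m)"
    by (simp add: chebyshev_U_Suc_Suc ge2 del: cheb_V.simps)
  also have "\<dots> = cheb_V z (Suc (Suc (Suc m)))"
    by (simp add: algebra_simps power2_eq_square)
  finally show ?case .
qed

text \<open>The recursion makes sense in every commutative ring, so it can be run on complex values
  and on Laurent series alike; this reduces the analytic claim to a formal one.\<close>

lemma has_laurent_expansion_cheb:
  assumes "f has_laurent_expansion F"
  shows "(\<lambda>x. cheb_T (f x) m) has_laurent_expansion cheb_T F m"
    and "(\<lambda>x. cheb_V (f x) m) has_laurent_expansion cheb_V F m"
proof (induction m)
  case 0
  show "(\<lambda>x. cheb_T (f x) 0) has_laurent_expansion cheb_T F 0"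
    "(\<lambda>x. cheb_V (f x) 0) has_laurent_expansion cheb_V F 0"
    by simp_all
next
  case (Suc m)
  show "(\<lambda>x. cheb_T (f x) (Suc m)) has_laurent_expansion cheb_T F (Suc m)"
    "(\<lambda>x. cheb_V (f x) (Suc m)) has_laurent_expansion cheb_V F (Suc m)"
    unfolding cheb_T.simps cheb_V.simps
    by (intro laurent_expansion_intros assms Suc)+
qed

text \<open>
  The derivative is taken with respect to $x$, and $y$ plays the role of $1/x$. These are
  $T_m' = m U_{m-1}$ and $(z^2-1) U_{m-1}' = m T_m - z U_{m-1}$ combined with the chain rule;
  neither goes through by induction without the other.
\<close>

lemma fls_deriv_cheb:
  fixes y :: "'a::comm_ring_1 fls"
  assumes "fls_deriv y = - y\<^sup>2"
  shows "fls_deriv (cheb_T y m) = - (of_nat m * y\<^sup>2 * cheb_V y m)"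
    and "(y\<^sup>2 - 1) * fls_deriv (cheb_V y m) =
           - (y\<^sup>2 * (of_nat m * cheb_T y m - y * cheb_V y m))"
proof (induction m)
  case 0
  show "fls_deriv (cheb_T y 0) = - (of_nat 0 * y\<^sup>2 * cheb_V y 0)"
    "(y\<^sup>2 - 1) * fls_deriv (cheb_V y 0) = - (y\<^sup>2 * (of_nat 0 * cheb_T y 0 - y * cheb_V y 0))"
    by simp_all
next
  case (Suc m)
  have "fls_deriv (cheb_T y (Suc m)) = y * fls_deriv (cheb_T y m) - y\<^sup>2 * cheb_T y m
      - 2 * y * y\<^sup>2 * cheb_V y m + (y\<^sup>2 - 1) * fls_deriv (cheb_V y m)"
    by (simp add: power2_eq_square[of y] fls_deriv_mult assms algebra_simps)
  also have "\<dots> = - (of_nat (Suc m) * y\<^sup>2 * cheb_V y (Suc m))"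
    unfolding Suc by (simp add: algebra_simps)
  finally show "fls_deriv (cheb_T y (Suc m)) = \<dots>" .
  have "(y\<^sup>2 - 1) * fls_deriv (cheb_V y (Suc m)) = y * ((y\<^sup>2 - 1) * fls_deriv (cheb_V y m))
      - (y\<^sup>2 - 1) * y\<^sup>2 * cheb_V y m + (y\<^sup>2 - 1) * fls_deriv (cheb_T y m)"
    by (simp add: fls_deriv_mult assms algebra_simps)
  also have "\<dots> = - (y\<^sup>2 * (of_nat (Suc m) * cheb_T y (Suc m) - y * cheb_V y (Suc m)))"
    unfolding Suc by (simp add: algebra_simps power2_eq_square)
  finally show "(y\<^sup>2 - 1) * fls_deriv (cheb_V y (Suc m)) = \<dots>" .
qed

text \<open>The recursion is multiplication by \<open>y + w\<close> in coordinates with respect to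
  \<open>1\<close> and \<open>w\<close>; replacing \<open>w\<close> by \<open>- w\<close> gives the
  powers of \<open>y - w\<close>.\<close>

lemma cheb_T_minus_cheb_V:
  fixes y w :: "'a::comm_ring_1"
  assumes "w\<^sup>2 = y\<^sup>2 - 1"
  shows "cheb_T y m - w * cheb_V y m = (y - w) ^ m"
proof (induction m)
  case (Suc m)
  have "(y - w) ^ Suc m = (y - w) * (cheb_T y m - w * cheb_V y m)"
    by (simp add: Suc)
  also have "\<dots> = y * cheb_T y m + w\<^sup>2 * cheb_V y m - w * (y * cheb_V y m + cheb_T y m)"
    by (simp add: algebra_simps power2_eq_square)
  finally show ?case by (simp add: assms)
qed simp

lemma fls_nth_X_inv_times:
  "fls_nth (fls_X_inv * f) k = fls_nth f (k + 1)"
  "fls_nth (fls_X_inv\<^sup>2 * f) k = fls_nth f (k + 2)"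
  by (simp_all add: fls_X_inv_times_conv_shift fls_X_inv_power_times_conv_shift)

lemma fls_nth_cheb_X_inv_eq_0:
  assumes "k > 0"
  shows "fls_nth (cheb_T (fls_X_inv :: 'a::comm_ring_1 fls) m) k = 0"
    and "fls_nth (cheb_V (fls_X_inv :: 'a fls) m) k = 0"
  using assms
  by (induction m arbitrary: k)
    (simp_all add: left_diff_distrib fls_nth_X_inv_times)

text \<open>Constant terms are values at y = 0, where one recursion step is the quarter turn (T, V)
  -> (-V, T), so two steps multiply by -1.\<close>

lemma fls_nth_0_cheb_X_inv:
  "fls_nth (cheb_V (fls_X_inv :: 'a::comm_ring_1 fls) (2 * k)) 0 = 0 \<and>
   fls_nth (cheb_T (fls_X_inv :: 'a fls) (2 * k)) 0 = (-1) ^ k"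
  by (induction k)
    (simp_all add: left_diff_distrib fls_nth_X_inv_times
      fls_nth_cheb_X_inv_eq_0)

text \<open>The hypotheses characterize the derivative of arcsin formally, as the inverse square
  root of 1 - x^2 with constant term 1.\<close>

lemma fls_nth_cheb_V_times_arcsin:
  fixes A :: "'a::field_char_0 fps"
  assumes "fps_deriv A ^ 2 * (1 - fps_X\<^sup>2) = 1" and "fps_nth (fps_deriv A) 0 = 1"
  shows "fls_nth (cheb_V fls_X_inv (Suc (2 * k)) * fps_to_fls A) 1 = (-1) ^ k / of_nat (Suc (2 * k))"
proof -
  define m where "m = Suc (2 * k)"
  define y :: "'a fls" where "y = fls_X_inv"
  define B where "B = fps_deriv A"
  define s where "s = B * (1 - fps_X\<^sup>2)"
  have Bs: "B * s = 1"
    using assms(1) by (simp add: s_def B_def power2_eq_square mult.assoc)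
  have "s\<^sup>2 = (B * s) * (1 - fps_X\<^sup>2)"
    by (simp add: s_def power2_eq_square mult_ac)
  hence s2: "s\<^sup>2 = 1 - fps_X\<^sup>2"
    by (simp add: Bs)
  have yX: "y * fls_X = 1"
    by (simp add: y_def flip: fls_inverse_X)
  have dy: "fls_deriv y = - y\<^sup>2"
    by (simp add: y_def power2_eq_square)
  \<comment> \<open>\<open>B\<close>, \<open>s\<close> and \<open>w\<close> stand for $1/\sqrt{1-x^2}$, $\sqrt{1-x^2}$ and $\sqrt{y^2-1}$.\<close>
  define w where "w = y * fps_to_fls s"
  have w2: "w\<^sup>2 = y\<^sup>2 - 1"
  proof -
    have "w\<^sup>2 = y\<^sup>2 * fps_to_fls (s\<^sup>2)" by (simp add: w_def power_mult_distrib fps_to_fls_power)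
    also have "\<dots> = y\<^sup>2 - (y * fls_X)\<^sup>2"
      unfolding s2 by (simp add: algebra_simps fps_to_fls_power power_mult_distrib)
    finally show ?thesis by (simp add: yX)
  qed
  \<comment> \<open>The choice of root matters here: \<open>s\<close> has constant term 1, so
    \<open>1 - s\<close> is divisible by x, which cancels the pole of \<open>y\<close>.\<close>
  have "fps_nth (1 - s) 0 = 0"
    using assms(2) by (simp add: s_def B_def)
  hence "1 - s = fps_X * fps_shift 1 (1 - s)"
    by (intro fps_ext) (auto simp del: fps_sub_nth)
  then obtain r where r: "1 - s = fps_X * r" ..
  have "y - w = y * fps_to_fls (1 - s)" by (simp add: w_def algebra_simps)
  also have "\<dots> = y * fls_X * fps_to_fls r" unfolding r by (simp add: fls_times_fps_to_fls)
  finally have yw: "y - w = fps_to_fls r" by (simp add: yX)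
  have "cheb_T y m * fps_to_fls B = (w * cheb_V y m + (y - w) ^ m) * fps_to_fls B"
    by (simp flip: cheb_T_minus_cheb_V[OF w2])
  also have "\<dots> = y * cheb_V y m * fps_to_fls (B * s) + fps_to_fls (r ^ m * B)"
    unfolding yw by (simp add: w_def algebra_simps fls_times_fps_to_fls fps_to_fls_power)
  finally have TB: "cheb_T y m * fps_to_fls B = y * cheb_V y m + fps_to_fls (r ^ m * B)"
    by (simp add: Bs)
  have "fls_residue (cheb_T y m * fps_to_fls B) = fls_nth (cheb_V y m) 0"
    unfolding TB by (simp add: y_def fls_nth_X_inv_times)
  \<comment> \<open>After one recursion step from index \<open>2 * k\<close>, the summand with
    factor \<open>y\<close> contributes a coefficient of x^1, which vanishes for a polynomial in
    1/x.\<close>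
  also have "\<dots> = (-1) ^ k"
    using fls_nth_0_cheb_X_inv[where 'a = 'a and k = k]
    by (simp add: m_def y_def fls_nth_X_inv_times fls_nth_cheb_X_inv_eq_0)
  finally have res: "fls_residue (cheb_T y m * fps_to_fls B) = (-1) ^ k" .
  have "fls_deriv (cheb_T y m * fps_to_fls A)
      = cheb_T y m * fps_to_fls B - of_nat m * (y\<^sup>2 * (cheb_V y m * fps_to_fls A))"
    by (simp add: fls_deriv_mult fls_deriv_cheb[OF dy] B_def fls_deriv_fps_to_fls algebra_simps)
  hence "0 = fls_residue (cheb_T y m * fps_to_fls B - of_nat m * (y\<^sup>2 * (cheb_V y m * fps_to_fls A)))"
    using fls_residue_deriv by metis
  \<comment> \<open>The factor \<open>y\<^sup>2\<close> lowers exponents by 2, so the residue picks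
    out the coefficient of x^1.\<close>
  also have "\<dots> = (-1) ^ k - of_nat m * fls_nth (cheb_V y m * fps_to_fls A) 1"
    using res by (simp add: fls_mult_of_nat_nth y_def fls_nth_X_inv_times)
  finally have "of_nat m * fls_nth (cheb_V y m * fps_to_fls A) 1 = (-1) ^ k" by simp
  moreover have "(of_nat m :: 'a) \<noteq> 0" unfolding m_def by (rule of_nat_neq_0)
  ultimately show ?thesis unfolding m_def[symmetric] y_def[symmetric]
    by (simp add: field_simps)
qed

lemma Arcsin_has_fps_expansion:
  obtains A where "Arcsin has_fps_expansion A"
    "fps_deriv A ^ 2 * (1 - fps_X\<^sup>2) = 1" "fps_nth (fps_deriv A) 0 = 1"
proof -
  have deriv: "(Arcsin has_field_derivative inverse (cos (Arcsin z))) (at z)"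
    if "z \<in> ball 0 1" for z
    using that abs_Re_le_cmod[of z] by (intro has_field_derivative_Arcsin) auto
  have "Arcsin holomorphic_on ball 0 1"
    unfolding holomorphic_on_open[OF open_ball] using deriv by blast
  hence "Arcsin analytic_on {0}"
    by (auto simp: analytic_at intro!: exI[of _ "ball 0 1"])
  hence A: "Arcsin has_fps_expansion fps_expansion Arcsin 0" (is "_ has_fps_expansion ?A")
    by (rule analytic_at_imp_has_fps_expansion_0)
  \<comment> \<open>Squaring avoids complex square roots; uniqueness of expansions then turns an
    identity near 0 into one of series.\<close>
  have "(\<lambda>z. deriv Arcsin z ^ 2 * (1 - z ^ 2)) has_fps_expansion fps_deriv ?A ^ 2 * (1 - fps_X\<^sup>2)"
    by (intro fps_expansion_intros A)
  moreover have "eventually (\<lambda>z. deriv Arcsin z ^ 2 * (1 - z ^ 2) = 1) (nhds 0)"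
    unfolding eventually_nhds
  proof (intro exI[of _ "ball 0 1"] conjI ballI)
    fix z :: complex assume z: "z \<in> ball 0 1"
    have "z\<^sup>2 \<noteq> 1" using z by (auto simp: power2_eq_1_iff)
    moreover have "cos (Arcsin z) ^ 2 = 1 - z\<^sup>2"
      by (simp add: cos_squared_eq)
    ultimately show "deriv Arcsin z ^ 2 * (1 - z ^ 2) = 1"
      using DERIV_imp_deriv[OF deriv[OF z]] by (simp add: power_inverse)
  qed auto
  ultimately have "(\<lambda>_. 1) has_fps_expansion fps_deriv ?A ^ 2 * (1 - fps_X\<^sup>2)"
    by (subst (asm) has_fps_expansion_cong) auto
  hence "fps_deriv ?A ^ 2 * (1 - fps_X\<^sup>2) = 1"
    by (rule fps_expansion_unique_complex) simp
  moreover have "fps_nth (fps_deriv ?A) 0 = 1"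
    using DERIV_imp_deriv[OF deriv[of 0]] by (simp add: fps_expansion_def)
  ultimately show ?thesis using A that by blast
qed

theorem proposition3p5:
  fixes n :: nat
  assumes "n \<ge> 1"
  shows "fls_nth (laurent_expansion (\<lambda>x. poly (chebyshev_U (2 * n - 2)) (1 / x) * Arcsin x) 0) 1
           = (-1) ^ (n - 1) / (2 * of_nat n - 1)"
proof -
  obtain k where n: "n = Suc k" using assms by (cases n) auto
  obtain A where A: "Arcsin has_fps_expansion A"
    "fps_deriv A ^ 2 * (1 - fps_X\<^sup>2) = 1" "fps_nth (fps_deriv A) 0 = 1"
    by (rule Arcsin_has_fps_expansion)
  have "(\<lambda>x::complex. 1 / x) has_laurent_expansion 1 / fls_X"
    by (intro laurent_expansion_intros)
  also have "1 / fls_X = (fls_X_inv :: complex fls)"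
    by (simp add: fls_inverse_X divide_inverse)
  finally have "(\<lambda>x. cheb_V (1 / x) (Suc (2 * k)) * Arcsin x) has_laurent_expansion
      cheb_V fls_X_inv (Suc (2 * k)) * fps_to_fls A"
    by (intro has_laurent_expansion_mult has_laurent_expansion_cheb has_laurent_expansion_fps A)
  from laurent_expansion_0_eqI[OF this] show ?thesis
    using fls_nth_cheb_V_times_arcsin[OF A(2,3), of k]
    by (simp add: n poly_chebyshev_U del: cheb_V.simps)
qed

end
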